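(* For each $N\in\{1,2,\dots\}$ let $w^{(N)}_1,\dots,w^{(N)}_N>0$, let $x^{(N)}_{1,0},\dots,x^{(N)}_{N,0}$ be a permutation of $1,\dots,N$, put $y^{(N)}_{i,0}=\frac1N(x^{(N)}_{i,0}-1)$, and let $\tau^{(N)}_1,\dots,\tau^{(N)}_N$ be independent random variables with $\mathrm{P}[\tau^{(N)}_i\le t]=1-e^{-w^{(N)}_i t}$ for $t\ge0$. Assume: (i) for each $0\le y<1$ there is a probability measure $\mu_{y,0}(dw)$ on $\mathbb{R}_+=[0,\infty)$ such that for every bounded continuous $g:\mathbb{R}_+\to\mathbb{R}$ the function $y\mapsto\int_0^\infty g(w)\,\mu_{y,0}(dw)$ is Lebesgue measurable and $$\lim_{N\to\infty}\ \sup_{y\in[0,1)}\left|\frac1N\sum_{i=1}^N g(w^{(N)}_i)\,\chi_{y^{(N)}_{i,0}\le y}-\int_0^y\left(\int_0^\infty g(w)\,\mu_{z,0}(dw)\right)dz\right|=0;$$ (ii) with $\lambda(dw)=\int_0^1\mu_{y,0}(dw)\,dy$, we have $\int_{[0,\infty)} w\,\lambda(dw)<\infty$; (iii) $\lambda(\{0\})=0$. For $0\le y<1$ and $t\ge0$ put $$y^{(N)}_C(y,t)=y+\frac1N\sum_{i=1}^N\chi_{\tau^{(N)}_i\le t}\,\chi_{y^{(N)}_{i,0}\ge y},\qquad y_C(y,t)=1-\int_y^1\int_0^\infty e^{-wt}\,\mu_{z,0}(dw)\,dz.$$ Then for all $0\le y<1$ and $t\ge0$, $$\lim_{N\to\infty}y^{(N)}_C(y,t)=y_C(y,t)\quad\text{in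 probability.}$$
   Context: $\chi_A$ is $1$ if $A$ is true and $0$ if $A$ is false. In the stochastic ranking process of $N$ particles, particle $i$ has initial rank $x^{(N)}_{i,0}$ and jumps to the top of the queue (rank $1$) at random times whose successive increments are i.i.d. exponential with rate $w^{(N)}_i$, independently among particles; $\tau^{(N)}_i$ is the first jump time of particle $i$. The quantity $y^{(N)}_C(y,t)$ represents the (random) scaled position at time $t$ of a particle that started at scaled position $y$ and has not jumped by time $t$. *)

theory Defs
  imports "HOL-Probability.Probability"
begin

definition scaled_init :: "(nat \<Rightarrow> nat \<Rightarrow> nat) \<Rightarrow> nat \<Rightarrow> nat \<Rightarrow> real" where
  "scaled_init x N i = (real (x N i) - 1) / real N"

definition yC_N ::
  "(nat \<Rightarrow> nat \<Rightarrow> nat) \<Rightarrow> (nat \<Rightarrow> nat \<Rightarrow> 'a \<Rightarrow> real) \<Rightarrow> nat \<Rightarrow> real \<Rightarrow> real \<Rightarrow> 'a \<Rightarrow> real" where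
  "yC_N x \<tau> N y t \<omega> =
     y + (1 / real N) * (\<Sum>i = 1..N. of_bool (\<tau> N i \<omega> \<le> t) * of_bool (scaled_init x N i \<ge> y))"

definition yC :: "(real \<Rightarrow> real measure) \<Rightarrow> real \<Rightarrow> real \<Rightarrow> real" where
  "yC \<mu> y t = 1 - (LINT z|lebesgue_on {y..<1}. LINT w|\<mu> z. exp (- w * t))"

(* The Giry bind is the mixture A \<mapsto> \<integral>\<^sub>0\<^sup>1 \<mu>\<^sub>y(A) dy (see emeasure_bind) as soon as \<mu> is a
   measurable kernel. For probability measures on the half line this is equivalent to measurability
   of y \<mapsto> \<integral> g d\<mu>\<^sub>y for every bounded continuous g. *)
definition mixture :: "(real \<Rightarrow> real measure) \<Rightarrow> real measure" where
  "mixture \<mu> = lebesgue_on {0..<1} \<bind> \<mu>"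

(* The N-th random variable may live on its own probability space; a single
   space is the case of constant M. *)
definition tendsto_in_probability ::
  "(nat \<Rightarrow> 'a measure) \<Rightarrow> (nat \<Rightarrow> 'a \<Rightarrow> real) \<Rightarrow> real \<Rightarrow> bool" where
  "tendsto_in_probability M X c \<longleftrightarrow>
     (\<forall>\<epsilon>>0. (\<lambda>N. measure (M N) {\<omega> \<in> space (M N). \<bar>X N \<omega> - c\<bar> > \<epsilon>}) \<longlonglongrightarrow> 0)"

end

theory Submission
  imports Defs
begin

text \<open>
  Hoeffding's inequality concentrates \<open>y\<^sub>C\<^sup>N(y, t)\<close> around its mean
  \<open>y + N\<inverse> \<Sum>\<^sub>i (1 - exp (- w\<^sub>i t)) \<chi>(y\<^sub>i \<ge> y)\<close>, so only the convergence of the means is at stake.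
  Assumption (i) for the test function \<open>1 - exp (- w t)\<close> controls the sums over \<open>y\<^sub>i \<le> y\<close>. It is
  uniform in \<open>y\<close>, so it can be used at the largest position \<open>1 - 1/N\<close>, where the sum runs over all
  particles; subtracting gives the sums over \<open>y\<^sub>i \<ge> y\<close>, up to the at most one particle at \<open>y\<close>.
\<close>

lemma abs_integral_lebesgue_on_le:
  fixes F :: "real \<Rightarrow> real"
  assumes A: "A \<in> lmeasurable" and F: "F \<in> borel_measurable (lebesgue_on A)"
    and B: "\<And>z. z \<in> A \<Longrightarrow> \<bar>F z\<bar> \<le> B"
  shows "\<bar>LINT z|lebesgue_on A. F z\<bar> \<le> B * measure lebesgue A"
proof -
  interpret finite_measure "lebesgue_on A"
    using A by (rule finite_measure_lebesgue_on)
  have int: "integrable (lebesgue_on A) F"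
    using B by (intro integrable_const_bound[of _ B] F) (auto intro: AE_I2)
  have "norm (LINT z|lebesgue_on A. F z) \<le> (LINT z|lebesgue_on A. B)"
    using B int by (intro Bochner_Integration.integral_norm_bound_integral) auto
  also have "\<dots> = B * measure lebesgue A"
    using A by (simp add: measure_restrict_space fmeasurableD)
  finally show ?thesis by simp
qed

text \<open>The two pieces share only the null set \<open>{b}\<close>. The left piece is closed to
  match the integrals over \<open>{0..y}\<close> in the limit hypothesis. Boundedness on a set of
  finite measure supplies the integrability that additivity requires.\<close>

lemma integral_lebesgue_on_split:
  fixes F :: "real \<Rightarrow> real"
  assumes ac: "a \<le> b" "b < c" and F: "F \<in> borel_measurable (lebesgue_on {a..<c})"
    and B: "\<And>z. z \<in> {a..<c} \<Longrightarrow> \<bar>F z\<bar> \<le> B"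
  shows "(LINT z|lebesgue_on {a..<c}. F z)
    = (LINT z|lebesgue_on {a..b}. F z) + (LINT z|lebesgue_on {b..<c}. F z)"
proof -
  have lm: "{a..<c} \<in> lmeasurable"
    by (rule bounded_set_imp_lmeasurable) auto
  interpret finite_measure "lebesgue_on {a..<c}"
    using lm by (rule finite_measure_lebesgue_on)
  have int: "integrable (lebesgue_on {a..<c}) F"
    using B by (intro integrable_const_bound[of _ B] F) (auto intro: AE_I2)
  hence si: "set_integrable lebesgue {a..<c} F"
    by (simp add: set_integrable_def integrable_restrict_space lm fmeasurableD)
  have eq: "(LINT z|lebesgue_on S. F z) = set_lebesgue_integral lebesgue S F"
    if "S \<in> sets lebesgue" for S
    using that by (simp add: set_lebesgue_integral_def integral_restrict_space)
  have "set_lebesgue_integral lebesgue ({a..b} \<union> {b..<c}) F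
     = set_lebesgue_integral lebesgue {a..b} F + set_lebesgue_integral lebesgue {b..<c} F"
  proof (rule set_integral_Un_AE)
    show "AE x in lebesgue. \<not> (x \<in> {a..b} \<and> x \<in> {b..<c})"
      by (rule AE_I'[of "{b}"]) auto
    show "set_integrable lebesgue {a..b} F" "set_integrable lebesgue {b..<c} F"
      using ac by (auto intro!: set_integrable_subset[OF si])
  qed auto
  moreover have "{a..b} \<union> {b..<c} = {a..<c}" using ac by auto
  ultimately show ?thesis by (simp add: eq)
qed

lemma scaled_init_le:
  assumes "bij_betw (x N) {1..N} {1..N}" "i \<in> {1..N}"
  shows "scaled_init x N i \<le> 1 - 1 / real N"
proof -
  have "x N i \<in> {1..N}" using assms by (auto simp: bij_betw_def)
  thus ?thesis by (simp add: scaled_init_def field_simps)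
qed

text \<open>This bounds the overlap between the particles at positions at most \<open>y\<close> and
  those at positions at least \<open>y\<close>; it follows from the injectivity of
  \<open>x N\<close>.\<close>

lemma card_scaled_init_eq_le_1:
  assumes "bij_betw (x N) {1..N} {1..N}"
  shows "card {i \<in> {1..N}. scaled_init x N i = y} \<le> 1"
proof -
  have "i = j" if "i \<in> {1..N}" "j \<in> {1..N}" "scaled_init x N i = scaled_init x N j" for i j
  proof -
    have "x N i = x N j" using that by (auto simp: scaled_init_def)
    thus ?thesis using assms that by (auto simp: bij_betw_def dest: inj_onD)
  qed
  thus ?thesis by (auto simp: card_le_Suc0_iff_eq)
qed

text \<open>The deterministic half, with rates and kernel abstracted away: \<open>a N i\<close> will
  be a test function at the rate of particle \<open>i\<close>, and \<open>F z\<close> its integral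
  against \<open>\<mu> z\<close>. All it takes from the kernel is that \<open>F\<close> is
  measurable and bounded.\<close>

lemma upper_sums_tendsto:
  fixes F :: "real \<Rightarrow> real" and a :: "nat \<Rightarrow> nat \<Rightarrow> real"
  assumes x: "\<And>N. N \<ge> 1 \<Longrightarrow> bij_betw (x N) {1..N} {1..N}"
    and a: "\<And>N i. N \<ge> 1 \<Longrightarrow> i \<in> {1..N} \<Longrightarrow> \<bar>a N i\<bar> \<le> B"
    and F: "F \<in> borel_measurable (lebesgue_on {0..<1})"
    and FB: "\<And>z. z \<in> {0..<1} \<Longrightarrow> \<bar>F z\<bar> \<le> B"
    and lim: "(\<lambda>N. SUP y\<in>{0..<1}.
         \<bar>(1 / real N) * (\<Sum>i = 1..N. a N i * of_bool (scaled_init x N i \<le> y))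
           - (LINT z|lebesgue_on {0..y}. F z)\<bar>) \<longlonglongrightarrow> 0"
    and y: "0 \<le> y" "y < 1"
  shows "(\<lambda>N. (1 / real N) * (\<Sum>i = 1..N. a N i * of_bool (scaled_init x N i \<ge> y)))
    \<longlonglongrightarrow> (LINT z|lebesgue_on {y..<1}. F z)"
proof -
  define I where "I A = (LINT z|lebesgue_on A. F z)" for A
  define S where "S N y = (1 / real N) * (\<Sum>i = 1..N. a N i * of_bool (scaled_init x N i \<le> y))" for N y
  define T where "T N = (1 / real N) * (\<Sum>i = 1..N. a N i * of_bool (scaled_init x N i \<ge> y))" for N
  define D where "D N = (SUP y\<in>{0..<1}. \<bar>S N y - I {0..y}\<bar>)" for N
  have B0: "B \<ge> 0" using FB[of 0] by auto
  have I_le: "\<bar>I A\<bar> \<le> B * measure lebesgue A" if "A \<subseteq> {0..<1}" "A \<in> sets lebesgue" for A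
    unfolding I_def
  proof (rule abs_integral_lebesgue_on_le)
    show "A \<in> lmeasurable"
      using that by (intro bounded_set_imp_lmeasurable) (auto intro: bounded_subset[of "{0..<1}"])
    show "F \<in> borel_measurable (lebesgue_on A)"
      using measurable_restrict_mono[OF F that(1)] .
  qed (use that FB in auto)
  \<comment> \<open>One \<open>D N\<close> pays for the cut at \<open>y\<close> and one for the cut
    at the last position \<open>u\<close>. One \<open>B / real N\<close> pays for the particle that
    may sit at \<open>y\<close>, the other for the integral over \<open>{u..<1}\<close>, an interval
    of length 1/N.\<close>
  have bound: "\<bar>T N - I {y..<1}\<bar> \<le> 2 * D N + 2 * B / real N" if N: "N \<ge> 1" for N
  proof -
    have sum_le: "\<bar>1 / real N * (\<Sum>i = 1..N. a N i * of_bool (P i))\<bar>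
        \<le> B * real (card {i\<in>{1..N}. P i}) / real N" for P
    proof -
      have "\<bar>\<Sum>i = 1..N. a N i * of_bool (P i)\<bar> \<le> (\<Sum>i = 1..N. B * of_bool (P i))"
        using a[OF N] by (intro order.trans[OF sum_abs] sum_mono) (auto simp: of_bool_def)
      also have "\<dots> = B * real (card {i\<in>{1..N}. P i})"
        by (simp add: sum_distrib_left[symmetric] Int_def del: sum_mult_of_bool_eq)
      finally show ?thesis
        using N by (simp add: abs_mult field_simps)
    qed
    \<comment> \<open>A supremum of reals dominates its members only if the set is bounded above.
      Here both the average and the integral are at most \<open>B\<close> in absolute value.\<close>
    have "bdd_above ((\<lambda>y. \<bar>S N y - I {0..y}\<bar>) ` {0..<1})"
    proof (rule bdd_aboveI2)
      fix u :: real assume u: "u \<in> {0..<1}"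
      have "card {i\<in>{1..N}. scaled_init x N i \<le> u} \<le> card {1..N}"
        by (rule card_mono) auto
      hence "B * real (card {i\<in>{1..N}. scaled_init x N i \<le> u}) \<le> B * real N"
        using B0 by (intro mult_left_mono) auto
      hence "\<bar>S N u\<bar> \<le> B"
        using sum_le[of "\<lambda>i. scaled_init x N i \<le> u"] N unfolding S_def by (auto simp: field_simps)
      moreover have "\<bar>I {0..u}\<bar> \<le> B * 1"
        using u B0 by (intro order.trans[OF I_le] mult_left_mono) auto
      ultimately show "\<bar>S N u - I {0..u}\<bar> \<le> 2 * B" by linarith
    qed
    hence le_D: "\<bar>S N u - I {0..u}\<bar> \<le> D N" if "u \<in> {0..<1}" for u
      unfolding D_def using that by (intro cSUP_upper) auto
    define u where "u = 1 - 1 / real N"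
    have u: "u \<in> {0..<1}" using N by (auto simp: u_def)
    define r where "r = 1 / real N * (\<Sum>i = 1..N. a N i * of_bool (scaled_init x N i = y))"
    \<comment> \<open>For a single position s this reads \<open>of_bool (y \<le> s) = 1 - of_bool (s
      \<le> y) + of_bool (s = y)\<close>, where the 1 is \<open>of_bool (s \<le> u)\<close> because
      no position exceeds \<open>u\<close>.\<close>
    have T: "T N = S N u - S N y + r"
      unfolding T_def r_def S_def right_diff_distrib[symmetric] distrib_left[symmetric]
        sum_subtractf[symmetric] sum.distrib[symmetric]
      using scaled_init_le[where x = x, OF x[OF N]]
      by (intro arg_cong2[where f = "(*)"] sum.cong refl) (auto simp: of_bool_def u_def)
    have r: "\<bar>r\<bar> \<le> B / real N"
      unfolding r_def
      using card_scaled_init_eq_le_1[where x = x and y = y, OF x[OF N]] B0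
      by (intro order.trans[OF sum_le] divide_right_mono) (auto intro: mult_left_le)
    have Iu: "I {0..<1} = I {0..u} + I {u..<1}"
      unfolding I_def using u by (intro integral_lebesgue_on_split[OF _ _ F FB]) auto
    have Iy: "I {0..<1} = I {0..y} + I {y..<1}"
      unfolding I_def using y by (intro integral_lebesgue_on_split[OF _ _ F FB]) auto
    have tail: "\<bar>I {u..<1}\<bar> \<le> B / real N"
      using I_le[of "{u..<1}"] u by (simp add: u_def)
    have "\<bar>T N - I {y..<1}\<bar> = \<bar>(S N u - I {0..u}) - (S N y - I {0..y}) + (r - I {u..<1})\<bar>"
      using T Iu Iy by simp
    also have "\<dots> \<le> \<bar>S N u - I {0..u}\<bar> + \<bar>S N y - I {0..y}\<bar> + (\<bar>r\<bar> + \<bar>I {u..<1}\<bar>)"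
      by (intro order.trans[OF abs_triangle_ineq] add_mono abs_triangle_ineq4)
    also have "\<dots> \<le> D N + D N + (B / real N + B / real N)"
      using u y by (intro add_mono le_D r tail) auto
    finally show ?thesis by simp
  qed
  have "(\<lambda>N. 2 * D N + 2 * B / real N) \<longlonglongrightarrow> 2 * 0 + 0"
    using lim unfolding D_def S_def I_def
    by (intro tendsto_intros lim_const_over_n)
  hence D_lim: "(\<lambda>N. 2 * D N + 2 * B / real N) \<longlonglongrightarrow> 0" by simp
  have "(\<lambda>N. T N - I {y..<1}) \<longlonglongrightarrow> 0"
  proof (rule Lim_null_comparison[OF _ D_lim])
    show "\<forall>\<^sub>F N in sequentially. norm (T N - I {y..<1}) \<le> 2 * D N + 2 * B / real N"
      unfolding real_norm_def using bound by (rule eventually_sequentiallyI)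
  qed
  thus ?thesis unfolding T_def I_def by (rule LIM_zero_cancel)
qed

text \<open>Hoeffding's bound depends only on the number of variables and their range, so the laws
  may vary with \<open>N\<close> and \<open>i\<close>. It is applied for each \<open>N\<close>
  separately, hence the spaces \<open>M N\<close> need not be related.\<close>

lemma averages_tendsto_in_probability:
  fixes X :: "nat \<Rightarrow> nat \<Rightarrow> 'a \<Rightarrow> real"
  assumes M: "\<And>N. N \<ge> 1 \<Longrightarrow> prob_space (M N)"
    and indep: "\<And>N. N \<ge> 1 \<Longrightarrow> prob_space.indep_vars (M N) (\<lambda>_. borel) (X N) {1..N}"
    and X01: "\<And>N i \<omega>. N \<ge> 1 \<Longrightarrow> i \<in> {1..N} \<Longrightarrow> \<omega> \<in> space (M N) \<Longrightarrow> X N i \<omega> \<in> {0..1}"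
    and lim: "(\<lambda>N. (1 / real N) * (\<Sum>i = 1..N. LINT \<omega>|M N. X N i \<omega>)) \<longlonglongrightarrow> m"
  shows "tendsto_in_probability M (\<lambda>N \<omega>. (1 / real N) * (\<Sum>i = 1..N. X N i \<omega>)) m"
  unfolding tendsto_in_probability_def
proof (intro allI impI)
  fix \<epsilon> :: real assume \<epsilon>: "\<epsilon> > 0"
  define e where "e N = (\<Sum>i = 1..N. LINT \<omega>|M N. X N i \<omega>)" for N
  let ?A = "\<lambda>N. {\<omega> \<in> space (M N). \<bar>(1 / real N) * (\<Sum>i = 1..N. X N i \<omega>) - m\<bar> > \<epsilon>}"
  \<comment> \<open>Half of \<epsilon> is spent on the distance of the mean from \<open>m\<close>; a
    deviation of more than \<epsilon> from \<open>m\<close> then forces one of at least \<epsilon>/2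
    from the mean.\<close>
  have "\<forall>\<^sub>F N in sequentially. \<bar>e N / real N - m\<bar> < \<epsilon> / 2"
    using tendstoD[OF lim, of "\<epsilon> / 2"] \<epsilon> by (simp add: dist_real_def e_def)
  hence ev: "\<forall>\<^sub>F N in sequentially. norm (measure (M N) (?A N)) \<le> 2 * exp (- (\<epsilon>\<^sup>2 / 2) * real N)"
    using eventually_ge_at_top[of 1]
  proof eventually_elim
    case (elim N)
    interpret prob_space "M N" using M elim by simp
    interpret Hoeffding_ineq "M N" "{1..N}" "X N" "\<lambda>_. 0" "\<lambda>_. 1" "e N"
      by unfold_locales (use elim indep X01 in \<open>auto simp: e_def\<close>)
    have "prob (?A N) \<le> prob {\<omega>\<in>space (M N). \<bar>(\<Sum>i\<in>{1..N}. X N i \<omega>) - e N\<bar> \<ge> real N * \<epsilon> / 2}"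
    proof (rule finite_measure_mono)
      show "?A N \<subseteq> {\<omega>\<in>space (M N). \<bar>(\<Sum>i\<in>{1..N}. X N i \<omega>) - e N\<bar> \<ge> real N * \<epsilon> / 2}"
      proof safe
        fix \<omega> assume "\<epsilon> < \<bar>1 / real N * (\<Sum>i = 1..N. X N i \<omega>) - m\<bar>"
        hence "\<epsilon> < \<bar>(\<Sum>i = 1..N. X N i \<omega>) / real N - m\<bar>" by simp
        hence "\<epsilon> / 2 \<le> \<bar>(\<Sum>i = 1..N. X N i \<omega>) / real N - e N / real N\<bar>"
          using elim(1) by (smt (verit) field_sum_of_halves)
        also have "\<dots> = \<bar>(\<Sum>i = 1..N. X N i \<omega>) - e N\<bar> / real N"
          by (simp add: diff_divide_distrib[symmetric])
        finally show "real N * \<epsilon> / 2 \<le> \<bar>(\<Sum>i = 1..N. X N i \<omega>) - e N\<bar>"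
          using elim by (simp add: field_simps)
      qed
    qed measurable
    \<comment> \<open>The sum has to deviate by N\<epsilon>/2, and the N squared ranges add up to N,
      which leaves the exponent -N\<epsilon>^2/2.\<close>
    also have "\<dots> \<le> 2 * exp (-2 * (real N * \<epsilon> / 2)\<^sup>2 / (\<Sum>i\<in>{1..N}. (1 - 0)\<^sup>2))"
      using \<epsilon> elim by (intro Hoeffding_ineq_abs_ge) auto
    also have "-2 * (real N * \<epsilon> / 2)\<^sup>2 / (\<Sum>i\<in>{1..N}. (1 - 0)\<^sup>2) = - (\<epsilon>\<^sup>2 / 2) * real N"
      using elim by (simp add: field_simps power2_eq_square)
    finally show ?case by simp
  qed
  have "((\<lambda>N. 2 * exp (- (\<epsilon>\<^sup>2 / 2) * real N)) \<longlonglongrightarrow> 2 * 0)"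
    using \<epsilon> by (intro tendsto_intros filterlim_compose[OF exp_at_bot]
      filterlim_tendsto_neg_mult_at_bot[OF tendsto_const] filterlim_real_sequentially) auto
  with ev show "(\<lambda>N. measure (M N) (?A N)) \<longlonglongrightarrow> 0"
    by (intro Lim_null_comparison[OF ev]) simp
qed

text \<open>\<open>yC\<close> is defined through survival probabilities, while the sums count jumps.
  Each \<open>\<mu> z\<close> has mass 1 and \<open>{y..<1}\<close> has length 1 - y, so passing to
  complements turns the leading 1 into \<open>y\<close>. The integrability facts matter because the
  integral of a non-integrable function is 0 by convention.\<close>

lemma yC_eq:
  fixes \<mu> :: "real \<Rightarrow> real measure"
  assumes \<mu>: "\<And>z. 0 \<le> z \<Longrightarrow> z < 1 \<Longrightarrow> prob_space (\<mu> z)"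
    and int: "\<And>z. 0 \<le> z \<Longrightarrow> z < 1 \<Longrightarrow> integrable (\<mu> z) (\<lambda>w. exp (- w * t))"
    and F: "(\<lambda>z. LINT w|\<mu> z. 1 - exp (- w * t)) \<in> borel_measurable (lebesgue_on {0..<1})"
    and FB: "\<And>z. 0 \<le> z \<Longrightarrow> z < 1 \<Longrightarrow> \<bar>LINT w|\<mu> z. 1 - exp (- w * t)\<bar> \<le> B"
    and y: "0 \<le> y" "y < 1"
  shows "yC \<mu> y t = y + (LINT z|lebesgue_on {y..<1}. LINT w|\<mu> z. 1 - exp (- w * t))"
proof -
  let ?F = "\<lambda>z. LINT w|\<mu> z. 1 - exp (- w * t)"
  have lm: "{y..<1} \<in> lmeasurable"
    by (rule bounded_set_imp_lmeasurable) auto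
  interpret finite_measure "lebesgue_on {y..<1}"
    using lm by (rule finite_measure_lebesgue_on)
  have F': "?F \<in> borel_measurable (lebesgue_on {y..<1})"
    by (rule measurable_restrict_mono[OF F]) (use y in auto)
  have iF: "integrable (lebesgue_on {y..<1}) ?F"
    using FB y by (intro integrable_const_bound[of _ B] F') (auto intro: AE_I2)
  have "(LINT z|lebesgue_on {y..<1}. LINT w|\<mu> z. exp (- w * t))
      = (LINT z|lebesgue_on {y..<1}. 1 - ?F z)"
  proof (rule Bochner_Integration.integral_cong[OF refl])
    fix z assume "z \<in> space (lebesgue_on {y..<1})"
    hence z: "0 \<le> z" "z < 1" using y by auto
    interpret prob_space "\<mu> z" using \<mu> z by simp
    show "(LINT w|\<mu> z. exp (- w * t)) = 1 - ?F z"
      using int[OF z] by (simp add: prob_space)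
  qed
  also have "\<dots> = (1 - y) - (LINT z|lebesgue_on {y..<1}. ?F z)"
    using y by (subst Bochner_Integration.integral_diff[OF _ iF]) (auto simp: measure_restrict_space)
  finally show ?thesis by (simp add: yC_def)
qed

theorem proposition8:
  fixes w :: "nat \<Rightarrow> nat \<Rightarrow> real"
    and x :: "nat \<Rightarrow> nat \<Rightarrow> nat"
    and M :: "nat \<Rightarrow> 'a measure"
    and \<tau> :: "nat \<Rightarrow> nat \<Rightarrow> 'a \<Rightarrow> real"
    and \<mu> :: "real \<Rightarrow> real measure"
  assumes w_pos: "\<And>N i. N \<ge> 1 \<Longrightarrow> i \<in> {1..N} \<Longrightarrow> w N i > 0"
    and x_perm: "\<And>N. N \<ge> 1 \<Longrightarrow> bij_betw (x N) {1..N} {1..N}"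
    and M_prob: "\<And>N. N \<ge> 1 \<Longrightarrow> prob_space (M N)"
    and tau_indep: "\<And>N. N \<ge> 1 \<Longrightarrow> prob_space.indep_vars (M N) (\<lambda>_. borel) (\<tau> N) {1..N}"
    and tau_distr: "\<And>N i t. N \<ge> 1 \<Longrightarrow> i \<in> {1..N} \<Longrightarrow> t \<ge> 0 \<Longrightarrow>
      measure (M N) {\<omega> \<in> space (M N). \<tau> N i \<omega> \<le> t} = 1 - exp (- w N i * t)"
    and mu_sets: "\<And>y. 0 \<le> y \<Longrightarrow> y < 1 \<Longrightarrow> sets (\<mu> y) = sets (restrict_space borel {0..})"
    and mu_prob: "\<And>y. 0 \<le> y \<Longrightarrow> y < 1 \<Longrightarrow> prob_space (\<mu> y)"
    and mu_measurable: "\<And>g :: real \<Rightarrow> real. continuous_on {0..} g \<Longrightarrow> bounded (g ` {0..}) \<Longrightarrow>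
      (\<lambda>y. LINT w|\<mu> y. g w) \<in> borel_measurable (lebesgue_on {0..<1})"
    and mu_limit: "\<And>g :: real \<Rightarrow> real. continuous_on {0..} g \<Longrightarrow> bounded (g ` {0..}) \<Longrightarrow>
      (\<lambda>N. SUP y\<in>{0..<1}.
         \<bar>(1 / real N) * (\<Sum>i = 1..N. g (w N i) * of_bool (scaled_init x N i \<le> y))
           - (LINT z|lebesgue_on {0..y}. LINT w|\<mu> z. g w)\<bar>) \<longlonglongrightarrow> 0"
    and mean_finite: "(\<integral>\<^sup>+ w. ennreal w \<partial>mixture \<mu>) < \<infinity>"
    and no_mass_zero: "emeasure (mixture \<mu>) {0} = 0"
  shows "\<forall>y t. 0 \<le> y \<and> y < 1 \<and> t \<ge> 0 \<longrightarrow>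
    tendsto_in_probability M (\<lambda>N. yC_N x \<tau> N y t) (yC \<mu> y t)"
proof (intro allI impI)
  fix y t :: real assume yt: "0 \<le> y \<and> y < 1 \<and> t \<ge> 0"
  \<comment> \<open>The probability that a particle of rate \<open>w\<close> has jumped by time
    \<open>t\<close>. It lies in [0,1] only for \<open>w \<ge> 0\<close>, so the bounds below rely
    on \<open>\<mu> z\<close> living on the half line.\<close>
  define g where "g w = 1 - exp (- w * t)" for w
  define m where "m = (LINT z|lebesgue_on {y..<1}. LINT w|\<mu> z. g w)"
  define X where "X N i \<omega> = of_bool (\<tau> N i \<omega> \<le> t) * (of_bool (scaled_init x N i \<ge> y) :: real)" for N i \<omega>
  have g01: "0 \<le> g v" "g v \<le> 1" if "v \<ge> 0" for v
    using that yt by (auto simp: g_def)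
  have g_cont: "continuous_on {0..} g"
    unfolding g_def by (intro continuous_intros)
  have g_bdd: "bounded (g ` {0..})"
    using g01 by (auto simp: bounded_iff intro!: exI[of _ 1])
  have \<mu>_space: "space (\<mu> z) = {0..}" if "0 \<le> z" "z < 1" for z
    using sets_eq_imp_space_eq[OF mu_sets[OF that]] by simp
  have g_int: "integrable (\<mu> z) g" if z: "0 \<le> z" "z < 1" for z
  proof -
    interpret prob_space "\<mu> z" using mu_prob z by simp
    have "g \<in> borel_measurable (\<mu> z)"
      unfolding measurable_cong_sets[OF mu_sets[OF z] refl]
      using g_cont by (rule borel_measurable_continuous_on_restrict)
    thus ?thesis
      using g01 \<mu>_space[OF z] by (intro integrable_const_bound[of _ 1]) (auto intro: AE_I2)
  qed
  have G_bound: "\<bar>LINT w|\<mu> z. g w\<bar> \<le> 1" if z: "0 \<le> z" "z < 1" for z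
  proof -
    interpret prob_space "\<mu> z" using mu_prob z by simp
    have "(LINT w|\<mu> z. g w) \<ge> 0" "(LINT w|\<mu> z. g w) \<le> 1"
      using g01 \<mu>_space[OF z] g_int[OF z] by (auto intro!: integral_le_const integral_ge_const AE_I2)
    thus ?thesis by simp
  qed
  have exp_int: "integrable (\<mu> z) (\<lambda>w. exp (- w * t))" if z: "0 \<le> z" "z < 1" for z
  proof -
    interpret prob_space "\<mu> z" using mu_prob z by simp
    have "integrable (\<mu> z) (\<lambda>w. 1 - g w)"
      using g_int[OF z] by (intro Bochner_Integration.integrable_diff) auto
    thus ?thesis by (simp add: g_def)
  qed
  have mean: "(LINT \<omega>|M N. X N i \<omega>) = g (w N i) * of_bool (scaled_init x N i \<ge> y)"
    if N: "N \<ge> 1" "i \<in> {1..N}" for N i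
  proof -
    interpret prob_space "M N" using M_prob N by simp
    \<comment> \<open>Measurability of each jump time is part of the definition of
      \<open>indep_vars\<close>.\<close>
    have [measurable]: "random_variable borel (\<tau> N i)"
      using tau_indep[OF N(1)] N(2) unfolding indep_vars_def by blast
    have "(LINT \<omega>|M N. of_bool (\<tau> N i \<omega> \<le> t) :: real)
        = (LINT \<omega>|M N. indicator {\<omega> \<in> space (M N). \<tau> N i \<omega> \<le> t} \<omega>)"
      by (rule Bochner_Integration.integral_cong) auto
    also have "\<dots> = measure (M N) {\<omega> \<in> space (M N). \<tau> N i \<omega> \<le> t}"
      by simp
    also have "\<dots> = g (w N i)"
      using tau_distr[OF N] yt by (simp add: g_def)
    finally show ?thesis by (simp add: X_def)
  qed
  have "(\<lambda>N. (1 / real N) * (\<Sum>i = 1..N. g (w N i) * of_bool (scaled_init x N i \<ge> y))) \<longlonglongrightarrow> m"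
    unfolding m_def
  proof (rule upper_sums_tendsto[where B = 1, OF x_perm])
    show "\<bar>g (w N i)\<bar> \<le> 1" if "N \<ge> 1" "i \<in> {1..N}" for N i
      using w_pos[OF that] g01[of "w N i"] by simp
  qed (use mu_measurable mu_limit g_cont g_bdd G_bound yt in auto)
  also have "(\<lambda>N. (1 / real N) * (\<Sum>i = 1..N. g (w N i) * of_bool (scaled_init x N i \<ge> y)))
      = (\<lambda>N. (1 / real N) * (\<Sum>i = 1..N. LINT \<omega>|M N. X N i \<omega>))"
  \<comment> \<open>No case split on \<open>N = 0\<close> is needed: the sums are then empty, and
    otherwise an index in \<open>{1..N}\<close> gives the \<open>N \<ge> 1\<close> that
    \<open>mean\<close> asks for.\<close>
  proof
    show "(1 / real N) * (\<Sum>i = 1..N. g (w N i) * of_bool (scaled_init x N i \<ge> y))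
      = (1 / real N) * (\<Sum>i = 1..N. LINT \<omega>|M N. X N i \<omega>)" for N
      by (intro arg_cong2[where f = "(*)"] sum.cong refl) (simp add: mean)
  qed
  \<comment> \<open>The rotation puts the premise on the means first, to meet the chained limit.
    Independence passes to \<open>X N i\<close> because it is a Borel function of
    \<open>\<tau> N i\<close> alone; the position factor is deterministic.\<close>
  finally have "tendsto_in_probability M (\<lambda>N \<omega>. (1 / real N) * (\<Sum>i = 1..N. X N i \<omega>)) m"
  proof (rule averages_tendsto_in_probability[rotated 3])
    show "prob_space.indep_vars (M N) (\<lambda>_. borel) (X N) {1..N}" if N: "N \<ge> 1" for N
    proof -
      interpret prob_space "M N" using M_prob N by simp
      show ?thesis
        unfolding X_def by (rule indep_vars_compose2[OF tau_indep[OF N]]) measurable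
    qed
  qed (use M_prob in \<open>auto simp: X_def\<close>)
  moreover have "yC \<mu> y t = y + m"
    unfolding m_def g_def
    by (rule yC_eq[OF mu_prob exp_int])
      (use mu_measurable[OF g_cont g_bdd] G_bound yt in \<open>auto simp: g_def\<close>)
  \<comment> \<open>The shift \<open>y\<close> occurs in both \<open>yC_N\<close> and
    \<open>yC\<close> and cancels in their difference.\<close>
  ultimately show "tendsto_in_probability M (\<lambda>N. yC_N x \<tau> N y t) (yC \<mu> y t)"
    by (simp add: tendsto_in_probability_def yC_N_def X_def)
qed

end
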